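(* Let $i\in\{1,2,3\}$, let $u_0$ satisfy hypothesis $(H_i)$ (recalled in the context), and let $u$ be the corresponding global solution of Problem $(P)$. Let $\Phi\in C^1(\mathbb{R})$ be such that $\Phi'$ is non-decreasing on $I_i$. Then $$E_i(u(t)):=(-1)^{i+1}\int_\Omega \Phi(u(x,t))\,dx$$ is a Lyapunov functional of Problem $(P)$, i.e. $t\mapsto E_i(u(t))$ is non-increasing on $[0,\infty)$. As a consequence, $\lim_{t\to\infty}E_i(u(t))$ exists (as a finite real number).
   Context: $\Omega$ is an open bounded subset of $\mathbb{R}^N$, $N\ge 1$. Set $f(z):=z^2(1-z)$ and $g(z):=z(1-z)$ for $z\in\mathbb{R}$. Problem $(P)$ is the nonlocal differential equation $u_t=u^2(1-u)-\lambda(t)\,u(1-u)$ for $x\in\Omega$, $t\ge 0$, with $u(x,0)=u_0(x)$, where $$\lambda(t):=\frac{\int_\Omega u^2(1-u)(x,t)\,dx}{\int_\Omega u(1-u)(x,t)\,dx}.$$ A (global) solution is a function $u\in C^1([0,\infty);L^\infty(\Omega))$ with $u(0)=u_0$, $\int_\Omega g(u(x,t))\,dx\ne 0$ for all $t\ge 0$, and $u_t(x,t)=f(u(x,t))-\lambda(t)g(u(x,t))$ for a.e. $x\in\Omega$ and all $t\ge0$. Hypotheses on the initial condition $u_0\in L^\infty(\Omega)$: $(H_1)$: $u_0\ge 1$ a.e. in $\Omega$ and $u_0\not\equiv 1$ (not a.e. equal to $1$). $(H_2)$: $0\le u_0\le 1$ a.e. in $\Omega$ and $u_0(1-u_0)\not\equiv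 0$. $(H_3)$: $u_0\le 0$ a.e. in $\Omega$ and $u_0\not\equiv 0$. Intervals: $I_1:=[1,\operatorname{ess\,sup}_\Omega u_0]$, $I_2:=[0,1]$, $I_3:=[\operatorname{ess\,inf}_\Omega u_0,0]$ (each used under the hypothesis with the same index). Known fact: if $(H_i)$ holds, Problem $(P)$ has a global solution $u\in C^1([0,\infty);L^\infty(\Omega))$, and $u(x,t)\in I_i$ for a.e. $x\in\Omega$ and all $t\ge0$; $u$ denotes this solution. *)

theory Defs
  imports "HOL-Analysis.Analysis" "HOL-Probability.Essential_Supremum"
begin

definition f_nl :: "real \<Rightarrow> real"
  where "f_nl z = z\<^sup>2 * (1 - z)"

definition g_nl :: "real \<Rightarrow> real"
  where "g_nl z = z * (1 - z)"

(* Elements of L^\<infinity>(\<Omega>) are handled through representatives; esssup is \<infinity> for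
   non-measurable functions. The value is extended real, so nothing is lost to a
   conversion of \<infinity> to 0. *)
definition Linf_norm :: "('a::euclidean_space) set \<Rightarrow> ('a \<Rightarrow> real) \<Rightarrow> ereal"
  where "Linf_norm \<Omega> w = esssup (lebesgue_on \<Omega>) (\<lambda>x. ereal \<bar>w x\<bar>)"

definition Linf :: "('a::euclidean_space) set \<Rightarrow> ('a \<Rightarrow> real) set"
  where "Linf \<Omega> = {w. w \<in> borel_measurable (lebesgue_on \<Omega>) \<and> Linf_norm \<Omega> w < \<infinity>}"

definition ess_sup :: "('a::euclidean_space) set \<Rightarrow> ('a \<Rightarrow> real) \<Rightarrow> real"
  where "ess_sup \<Omega> w = real_of_ereal (esssup (lebesgue_on \<Omega>) (\<lambda>x. ereal (w x)))"

definition ess_inf :: "('a::euclidean_space) set \<Rightarrow> ('a \<Rightarrow> real) \<Rightarrow> real"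
  where "ess_inf \<Omega> w = - ess_sup \<Omega> (\<lambda>x. - w x)"

(* u \<in> C^1([0,\<infinity>); L^\<infinity>(\<Omega>)) with derivative ut; difference quotients and continuity
   are taken in the norm of L^\<infinity>(\<Omega>), one-sided at t = 0. *)
definition C1_Linf_deriv ::
    "('a::euclidean_space) set \<Rightarrow> (real \<Rightarrow> 'a \<Rightarrow> real) \<Rightarrow> (real \<Rightarrow> 'a \<Rightarrow> real) \<Rightarrow> bool"
  where "C1_Linf_deriv \<Omega> u ut \<longleftrightarrow>
    (\<forall>t\<ge>0. u t \<in> Linf \<Omega> \<and> ut t \<in> Linf \<Omega> \<and>
      ((\<lambda>s. Linf_norm \<Omega> (\<lambda>x. (u s x - u t x) / (s - t) - ut t x)) \<longlongrightarrow> 0) (at t within {0..}) \<and>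
      ((\<lambda>s. Linf_norm \<Omega> (\<lambda>x. ut s x - ut t x)) \<longlongrightarrow> 0) (at t within {0..}))"

definition lambda_nl :: "('a::euclidean_space) set \<Rightarrow> ('a \<Rightarrow> real) \<Rightarrow> real"
  where "lambda_nl \<Omega> w =
    (LINT x|lebesgue_on \<Omega>. f_nl (w x)) / (LINT x|lebesgue_on \<Omega>. g_nl (w x))"

definition global_solution ::
    "('a::euclidean_space) set \<Rightarrow> ('a \<Rightarrow> real) \<Rightarrow> (real \<Rightarrow> 'a \<Rightarrow> real) \<Rightarrow> bool"
  where "global_solution \<Omega> u0 u \<longleftrightarrow>
    (AE x in lebesgue_on \<Omega>. u 0 x = u0 x) \<and>
    (\<forall>t\<ge>0. (LINT x|lebesgue_on \<Omega>. g_nl (u t x)) \<noteq> 0) \<and>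
    (\<exists>ut. C1_Linf_deriv \<Omega> u ut \<and>
      (\<forall>t\<ge>0. AE x in lebesgue_on \<Omega>.
         ut t x = f_nl (u t x) - lambda_nl \<Omega> (u t) * g_nl (u t x)))"

definition H1 :: "('a::euclidean_space) set \<Rightarrow> ('a \<Rightarrow> real) \<Rightarrow> bool"
  where "H1 \<Omega> u0 \<longleftrightarrow>
    (AE x in lebesgue_on \<Omega>. 1 \<le> u0 x) \<and> \<not> (AE x in lebesgue_on \<Omega>. u0 x = 1)"

definition H2 :: "('a::euclidean_space) set \<Rightarrow> ('a \<Rightarrow> real) \<Rightarrow> bool"
  where "H2 \<Omega> u0 \<longleftrightarrow>
    (AE x in lebesgue_on \<Omega>. 0 \<le> u0 x \<and> u0 x \<le> 1) \<and>
    \<not> (AE x in lebesgue_on \<Omega>. u0 x * (1 - u0 x) = 0)"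

definition H3 :: "('a::euclidean_space) set \<Rightarrow> ('a \<Rightarrow> real) \<Rightarrow> bool"
  where "H3 \<Omega> u0 \<longleftrightarrow>
    (AE x in lebesgue_on \<Omega>. u0 x \<le> 0) \<and> \<not> (AE x in lebesgue_on \<Omega>. u0 x = 0)"

definition hyp :: "nat \<Rightarrow> ('a::euclidean_space) set \<Rightarrow> ('a \<Rightarrow> real) \<Rightarrow> bool"
  where "hyp i \<Omega> u0 \<longleftrightarrow>
    (i = 1 \<and> H1 \<Omega> u0) \<or> (i = 2 \<and> H2 \<Omega> u0) \<or> (i = 3 \<and> H3 \<Omega> u0)"

(* Only meaningful for i \<in> {1, 2, 3}; any other index falls into the last branch. *)
definition inv_interval :: "nat \<Rightarrow> ('a::euclidean_space) set \<Rightarrow> ('a \<Rightarrow> real) \<Rightarrow> real set"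
  where "inv_interval i \<Omega> u0 =
    (if i = 1 then {1 .. ess_sup \<Omega> u0}
     else if i = 2 then {0 .. 1}
     else {ess_inf \<Omega> u0 .. 0})"

definition lyap :: "nat \<Rightarrow> ('a::euclidean_space) set \<Rightarrow> (real \<Rightarrow> real) \<Rightarrow> ('a \<Rightarrow> real) \<Rightarrow> real"
  where "lyap i \<Omega> \<Phi> w = (-1) ^ (i + 1) * (LINT x|lebesgue_on \<Omega>. \<Phi> (w x))"

end

theory Submission
  imports Defs
begin

(* Differentiating under the integral gives d/dt \<integral> \<Phi>(u) = \<integral> \<Phi>'(u) g(u) (u - \<lambda>). The choice of \<lambda>
   makes \<integral> g(u) (u - \<lambda>) vanish, so \<Phi>'(u) may be replaced by \<Phi>'(u) - \<Phi>'(\<lambda>). Since g does not change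
   sign on the invariant interval, \<lambda> is a weighted mean of u, so it lies in that interval, and
   monotonicity of \<Phi>' gives (\<Phi>'(u) - \<Phi>'(\<lambda>)) (u - \<lambda>) \<ge> 0. Hence the sign of g decides the sign of
   the derivative. *)

section \<open>Integrability and essential bounds\<close>

lemma integrable_continuous_comp:
  fixes w :: "'a \<Rightarrow> real" and h :: "real \<Rightarrow> real"
  assumes "finite_measure M" "w \<in> borel_measurable M" "continuous_on UNIV h"
    and "AE x in M. w x \<in> {a..b}"
  shows "integrable M (\<lambda>x. h (w x))"
proof -
  have "compact (h ` {a..b})"
    using assms(3) by (intro compact_continuous_image) (auto intro: continuous_on_subset)
  then obtain B where B: "\<And>z. z \<in> {a..b} \<Longrightarrow> norm (h z) \<le> B"
    by (meson bounded_iff compact_imp_bounded imageI)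
  have "AE x in M. norm (h (w x)) \<le> B"
    using assms(4) by eventually_elim (use B in auto)
  moreover have "(\<lambda>x. h (w x)) \<in> borel_measurable M"
    using assms(2,3) borel_measurable_continuous_on by blast
  ultimately show ?thesis
    by (rule finite_measure.integrable_const_bound[OF assms(1)])
qed

lemma AE_abs_le_Linf_norm: "AE x in lebesgue_on \<Omega>. ereal \<bar>w x\<bar> \<le> Linf_norm \<Omega> w"
  unfolding Linf_norm_def by (rule esssup_AE)

lemma Linf_AE_bounded:
  assumes "w \<in> Linf \<Omega>"
  obtains B where "AE x in lebesgue_on \<Omega>. \<bar>w x\<bar> \<le> B"
proof -
  \<comment> \<open>On a null set the essential supremum is \<open>-\<infinity>\<close>, so a finite
    norm cannot be presupposed; a real upper bound exists in either case.\<close>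
  obtain B where "Linf_norm \<Omega> w \<le> ereal B"
    using assms unfolding Linf_def
    by (cases "Linf_norm \<Omega> w") auto
  then have "AE x in lebesgue_on \<Omega>. \<bar>w x\<bar> \<le> B"
    using AE_abs_le_Linf_norm[of w \<Omega>]
    by (elim AE_mp, intro AE_I2 impI) (metis ereal_less_eq(3) order_trans)
  then show thesis by (rule that)
qed

section \<open>Differentiation under the integral sign\<close>

text \<open>The null set outside which the difference quotient is controlled by its norm depends on
  the time \<open>s\<close>. Along a sequence only countably many such sets occur, so one null set
  serves all \<open>n\<close> and norm convergence becomes pointwise convergence a.e. The second
  claim supplies the domination for dominated convergence.\<close>

lemma Linf_deriv_sequentially:
  assumes u: "C1_Linf_deriv \<Omega> u ut" and t: "t \<ge> 0"
    and s: "\<And>n. s n \<in> {0..} - {t}" "s \<longlonglongrightarrow> t"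
  shows "AE x in lebesgue_on \<Omega>. (\<lambda>n. (u (s n) x - u t x) / (s n - t)) \<longlonglongrightarrow> ut t x"
    and "\<forall>\<^sub>F n in sequentially. AE x in lebesgue_on \<Omega>.
           \<bar>(u (s n) x - u t x) / (s n - t) - ut t x\<bar> \<le> 1"
proof -
  define r where "r n x = (u (s n) x - u t x) / (s n - t) - ut t x" for n x
  have "((\<lambda>s. Linf_norm \<Omega> (\<lambda>x. (u s x - u t x) / (s - t) - ut t x)) \<longlongrightarrow> 0) (at t within {0..})"
    using u t unfolding C1_Linf_deriv_def by blast
  then have lim: "(\<lambda>n. Linf_norm \<Omega> (r n)) \<longlonglongrightarrow> 0"
    unfolding tendsto_at_iff_sequentially comp_def r_def using s by blast
  have small: "\<forall>\<^sub>F n in sequentially. Linf_norm \<Omega> (r n) < ereal e" if "e > 0" for e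
    using lim that by (intro order_tendstoD(2)[OF lim]) auto
  have bound: "AE x in lebesgue_on \<Omega>. \<forall>n. ereal \<bar>r n x\<bar> \<le> Linf_norm \<Omega> (r n)"
    using AE_abs_le_Linf_norm by (subst AE_all_countable) blast
  show "AE x in lebesgue_on \<Omega>. (\<lambda>n. (u (s n) x - u t x) / (s n - t)) \<longlonglongrightarrow> ut t x"
    using bound
  proof eventually_elim
    fix x assume x: "\<forall>n. ereal \<bar>r n x\<bar> \<le> Linf_norm \<Omega> (r n)"
    have "(\<lambda>n. r n x) \<longlonglongrightarrow> 0"
    proof (rule tendstoI)
      fix e :: real assume "e > 0"
      from small[OF this] show "\<forall>\<^sub>F n in sequentially. dist (r n x) 0 < e"
        by eventually_elim
           (use x in \<open>metis dist_0_norm dist_commute ereal_less(2) less_ereal.simps(1)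
             order_le_less_trans real_norm_def\<close>)
    qed
    then show "(\<lambda>n. (u (s n) x - u t x) / (s n - t)) \<longlonglongrightarrow> ut t x"
      unfolding r_def by (rule LIM_zero_cancel)
  qed
  show "\<forall>\<^sub>F n in sequentially. AE x in lebesgue_on \<Omega>.
          \<bar>(u (s n) x - u t x) / (s n - t) - ut t x\<bar> \<le> 1"
    using small[OF zero_less_one]
  proof eventually_elim
    case (elim n)
    show ?case
      using AE_abs_le_Linf_norm[of "r n" \<Omega>]
    proof eventually_elim
      case (elim x)
      then have "ereal \<bar>r n x\<bar> < ereal 1"
        using \<open>Linf_norm \<Omega> (r n) < ereal 1\<close> by (rule order_le_less_trans)
      then show ?case by (simp add: r_def)
    qed
  qed
qed

text \<open>A chain rule for values known only along a sequence. Caratheodory's factorisation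
  \<open>\<Phi> z - \<Phi> v0 = c z * (z - v0)\<close> avoids dividing by \<open>v n - v0\<close>,
  which may vanish.\<close>

lemma DERIV_comp_sequentially:
  fixes v q s :: "nat \<Rightarrow> real"
  assumes "(\<Phi> has_real_derivative d) (at v0)" "s \<longlonglongrightarrow> t" "\<And>n. s n \<noteq> t"
    and "(\<lambda>n. (v n - v0) / (s n - t)) \<longlonglongrightarrow> l"
  shows "(\<lambda>n. (\<Phi> (v n) - \<Phi> v0) / (s n - t)) \<longlonglongrightarrow> d * l"
proof -
  from assms(1) obtain c where c: "\<And>z. \<Phi> z - \<Phi> v0 = c z * (z - v0)" "isCont c v0" "c v0 = d"
    unfolding CARAT_DERIV by blast
  have "(\<lambda>n. (v n - v0) / (s n - t) * (s n - t)) \<longlonglongrightarrow> l * 0"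
    using assms(2,4) by (intro tendsto_mult LIM_zero)
  then have "v \<longlonglongrightarrow> v0"
    using assms(3) by (simp add: LIM_zero_cancel)
  then have "(\<lambda>n. c (v n)) \<longlonglongrightarrow> d"
    using c(2,3) isCont_tendsto_compose by blast
  from tendsto_mult[OF this assms(4)] show ?thesis
    by (simp add: c(1))
qed

text \<open>Dominated convergence for the difference quotients of \<open>\<Phi> (u t x)\<close>
  along an arbitrary sequence of times. Their pointwise limit comes from the chain rule, their bound
  from the Lipschitz continuity of \<open>\<Phi>\<close> on the interval containing almost all
  values of \<open>u\<close>.\<close>

lemma has_derivative_integral_comp:
  assumes fin: "finite_measure (lebesgue_on \<Omega>)" and u: "C1_Linf_deriv \<Omega> u ut"
    and range: "\<forall>t\<ge>0. AE x in lebesgue_on \<Omega>. u t x \<in> {a..b}"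
    and \<Phi>: "\<And>z. (\<Phi> has_real_derivative \<phi> z) (at z)" and \<phi>: "continuous_on UNIV \<phi>"
    and t: "t \<ge> 0"
  shows "((\<lambda>t. LINT x|lebesgue_on \<Omega>. \<Phi> (u t x)) has_real_derivative
           (LINT x|lebesgue_on \<Omega>. \<phi> (u t x) * ut t x)) (at t within {0..})"
  unfolding has_field_derivative_iff tendsto_at_iff_sequentially comp_def
proof (intro allI impI)
  fix s assume "\<forall>n. s n \<in> {0..} - {t}" and st: "s \<longlonglongrightarrow> t"
  then have s: "\<And>n. s n \<in> {0..} - {t}" by blast
  then have s0: "s n \<ge> 0" and snt: "s n \<noteq> t" for n by auto
  let ?M = "lebesgue_on \<Omega>"
  have meas: "u t \<in> borel_measurable ?M" "ut t \<in> borel_measurable ?M" if "t \<ge> 0" for t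
    using u that unfolding C1_Linf_deriv_def Linf_def by auto
  have cont: "continuous_on UNIV \<Phi>"
    using \<Phi> DERIV_isCont continuous_at_imp_continuous_on by blast
  have int: "integrable ?M (\<lambda>x. \<Phi> (u t x))" if "t \<ge> 0" for t
    using integrable_continuous_comp[OF fin meas(1) cont] range that by blast
  obtain B where B: "AE x in ?M. \<bar>ut t x\<bar> \<le> B"
    using u t Linf_AE_bounded unfolding C1_Linf_deriv_def by metis
  have "compact (\<phi> ` {a..b})"
    using \<phi> by (intro compact_continuous_image) (auto intro: continuous_on_subset)
  then obtain K where K: "\<And>z. z \<in> {a..b} \<Longrightarrow> \<bar>\<phi> z\<bar> \<le> K"
    by (metis bounded_iff compact_imp_bounded imageI real_norm_def)
  \<comment> \<open>The mean value inequality on the convex set \<open>{a..b}\<close> makes the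
    bound \<open>K\<close> for \<open>\<phi>\<close> a Lipschitz constant of
    \<open>\<Phi>\<close>.\<close>
  have lip: "\<bar>\<Phi> y - \<Phi> z\<bar> \<le> K * \<bar>y - z\<bar>" if "y \<in> {a..b}" "z \<in> {a..b}" for y z
    using field_differentiable_bound[of "{a..b}" \<Phi> \<phi> K y z] that \<Phi> K
    by (auto simp: has_field_derivative_at_within)
  define Q where "Q n x = (\<Phi> (u (s n) x) - \<Phi> (u t x)) / (s n - t)" for n x
  have Qm: "Q n \<in> borel_measurable ?M" for n
    using int[OF s0[of n]] int[OF t] unfolding Q_def by measurable
  have lim: "AE x in ?M. (\<lambda>n. Q n x) \<longlonglongrightarrow> \<phi> (u t x) * ut t x"
    using Linf_deriv_sequentially(1)[OF u t s st]
    by eventually_elim (use DERIV_comp_sequentially[OF \<Phi> st snt] Q_def in auto)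
  obtain N where N: "\<And>n. n \<ge> N \<Longrightarrow> AE x in ?M.
      \<bar>(u (s n) x - u t x) / (s n - t) - ut t x\<bar> \<le> 1"
    using Linf_deriv_sequentially(2)[OF u t s st] unfolding eventually_sequentially by blast
  \<comment> \<open>The quotients of \<open>u\<close> are within 1 of \<open>ut t\<close>, which is
    bounded by \<open>B\<close>; the Lipschitz constant contributes the factor
    \<open>K\<close>.\<close>
  have dom: "AE x in ?M. norm (Q n x) \<le> K * (B + 1)" if "n \<ge> N" for n
    using N[OF that] B range[rule_format, OF t] range[rule_format, OF s0[of n]]
  proof eventually_elim
    case (elim x)
    \<comment> \<open>The value \<open>u t x\<close> witnesses that \<open>{a..b}\<close> is
      nonempty; over an empty interval \<open>K\<close> could be negative.\<close>
    have K0: "K \<ge> 0" using K[OF elim(3)] by linarith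
    have "\<bar>Q n x\<bar> \<le> K * \<bar>u (s n) x - u t x\<bar> / \<bar>s n - t\<bar>"
      unfolding Q_def abs_divide by (intro divide_right_mono lip elim) auto
    also have "\<dots> = K * \<bar>(u (s n) x - u t x) / (s n - t)\<bar>"
      by (simp add: abs_divide)
    also have "\<dots> \<le> K * (B + 1)"
      using elim(1,2) by (intro mult_left_mono K0) linarith
    finally show ?case by simp
  qed
  have \<phi>m: "(\<lambda>x. \<phi> (u t x) * ut t x) \<in> borel_measurable ?M"
    using borel_measurable_continuous_on[OF \<phi> meas(1)[OF t]] meas(2)[OF t] by measurable
  \<comment> \<open>The domination is available from index \<open>N\<close> on, so the theorem is
    applied to the shifted sequence and the shift is removed afterwards.\<close>
  have "(\<lambda>n. LINT x|?M. Q (n + N) x) \<longlonglongrightarrow> (LINT x|?M. \<phi> (u t x) * ut t x)"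
  proof (rule integral_dominated_convergence[where w = "\<lambda>_. K * (B + 1)"])
    show "AE x in ?M. (\<lambda>n. Q (n + N) x) \<longlonglongrightarrow> \<phi> (u t x) * ut t x"
      using lim by eventually_elim (rule LIMSEQ_ignore_initial_segment)
    show "integrable ?M (\<lambda>_. K * (B + 1))"
      using fin by (simp add: finite_measure.integrable_const)
  qed (use \<phi>m Qm dom in auto)
  then have "(\<lambda>n. LINT x|?M. Q n x) \<longlonglongrightarrow> (LINT x|?M. \<phi> (u t x) * ut t x)"
    by (rule LIMSEQ_offset)
  moreover have "(LINT x|?M. Q n x) =
      ((LINT x|?M. \<Phi> (u (s n) x)) - (LINT x|?M. \<Phi> (u t x))) / (s n - t)" for n
    unfolding Q_def using int[OF s0[of n]] int[OF t] by simp
  ultimately show "(\<lambda>n. ((LINT x|?M. \<Phi> (u (s n) x)) - (LINT x|?M. \<Phi> (u t x))) / (s n - t))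
      \<longlonglongrightarrow> (LINT x|?M. \<phi> (u t x) * ut t x)"
    by simp
qed

section \<open>The nonlocal coefficient and the sign of the dissipation\<close>

text \<open>The factor \<open>\<sigma>\<close> treats both signs of \<open>g_nl\<close> at once:
  \<open>\<sigma> * g_nl (w x)\<close> is a nonnegative weight, and since
  \<open>f_nl z = z * g_nl z\<close>, integrating \<open>a \<le> w x \<le> b\<close> against it
  gives the two bounds.\<close>

lemma lambda_nl_in_interval:
  fixes w :: "'a::euclidean_space \<Rightarrow> real"
  assumes fin: "finite_measure (lebesgue_on \<Omega>)" and w: "w \<in> borel_measurable (lebesgue_on \<Omega>)"
    and range: "AE x in lebesgue_on \<Omega>. w x \<in> {a..b}"
    and g: "\<And>z. z \<in> {a..b} \<Longrightarrow> \<sigma> * g_nl z \<ge> 0"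
    and nz: "(LINT x|lebesgue_on \<Omega>. g_nl (w x)) \<noteq> 0" and "\<sigma> \<noteq> 0"
  shows "lambda_nl \<Omega> w \<in> {a..b}"
proof -
  let ?M = "lebesgue_on \<Omega>"
  define F where "F = (LINT x|?M. f_nl (w x))"
  define G where "G = (LINT x|?M. g_nl (w x))"
  have intf: "integrable ?M (\<lambda>x. f_nl (w x))" and intg: "integrable ?M (\<lambda>x. g_nl (w x))"
    unfolding f_nl_def g_nl_def
    by (rule integrable_continuous_comp[OF fin w _ range]; intro continuous_intros)+
  have fg: "f_nl z = z * g_nl z" for z
    by (simp add: f_nl_def g_nl_def power2_eq_square)
  have "0 \<le> (LINT x|?M. \<sigma> * g_nl (w x))"
    by (rule integral_nonneg_AE) (use range in eventually_elim, use g in auto)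
  \<comment> \<open>A nonnegative total mass that is nonzero is positive, so dividing by it later
    preserves the inequalities.\<close>
  then have G: "\<sigma> * G > 0"
    using nz \<open>\<sigma> \<noteq> 0\<close> by (simp add: G_def order_less_le)
  have "0 \<le> (LINT x|?M. \<sigma> * (f_nl (w x) - a * g_nl (w x)))"
  proof (rule integral_nonneg_AE, use range in eventually_elim)
    case (elim x)
    then have "0 \<le> (w x - a) * (\<sigma> * g_nl (w x))"
      using g[OF elim] by (intro mult_nonneg_nonneg[of _ "\<sigma> * g_nl (w x)"]) auto
    then show ?case by (simp add: fg algebra_simps)
  qed
  then have "a * (\<sigma> * G) \<le> \<sigma> * F"
    using intf intg by (simp add: F_def G_def algebra_simps)
  moreover have "0 \<le> (LINT x|?M. \<sigma> * (b * g_nl (w x) - f_nl (w x)))"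
  proof (rule integral_nonneg_AE, use range in eventually_elim)
    case (elim x)
    then have "0 \<le> (b - w x) * (\<sigma> * g_nl (w x))"
      using g[OF elim] by (intro mult_nonneg_nonneg[of _ "\<sigma> * g_nl (w x)"]) auto
    then show ?case by (simp add: fg algebra_simps)
  qed
  then have "\<sigma> * F \<le> b * (\<sigma> * G)"
    using intf intg by (simp add: F_def G_def algebra_simps)
  moreover have "lambda_nl \<Omega> w = \<sigma> * F / (\<sigma> * G)"
    using \<open>\<sigma> \<noteq> 0\<close> by (simp add: lambda_nl_def F_def G_def)
  ultimately show ?thesis
    using G by (simp only: atLeastAtMost_iff pos_le_divide_eq pos_divide_le_eq)
qed

text \<open>After subtracting \<open>\<phi> l\<close> times a vanishing integral, the integrand
  times \<open>\<sigma>\<close> factors into \<open>(\<phi> (w x) - \<phi> l) * (w x - l)\<close>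
  and \<open>\<sigma> * g_nl (w x)\<close>, both nonnegative. Comparing \<open>\<phi> (w x)\<close>
  with \<open>\<phi> l\<close> requires \<open>l\<close> to lie in \<open>{a..b}\<close>, where
  \<open>\<phi>\<close> is monotone.\<close>

lemma integral_mono_reaction_sign:
  fixes w :: "'a::euclidean_space \<Rightarrow> real"
  assumes fin: "finite_measure (lebesgue_on \<Omega>)" and w: "w \<in> borel_measurable (lebesgue_on \<Omega>)"
    and range: "AE x in lebesgue_on \<Omega>. w x \<in> {a..b}"
    and g: "\<And>z. z \<in> {a..b} \<Longrightarrow> \<sigma> * g_nl z \<ge> 0"
    and nz: "(LINT x|lebesgue_on \<Omega>. g_nl (w x)) \<noteq> 0" and "\<sigma> \<noteq> 0"
    and \<phi>: "continuous_on UNIV \<phi>" "mono_on {a..b} \<phi>"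
  shows "0 \<le> \<sigma> * (LINT x|lebesgue_on \<Omega>. \<phi> (w x) * (f_nl (w x) - lambda_nl \<Omega> w * g_nl (w x)))"
proof -
  let ?M = "lebesgue_on \<Omega>"
  define l where "l = lambda_nl \<Omega> w"
  have l: "l \<in> {a..b}"
    unfolding l_def by (rule lambda_nl_in_interval[OF fin w range g nz \<open>\<sigma> \<noteq> 0\<close>])
  have intf: "integrable ?M (\<lambda>x. f_nl (w x))" and intg: "integrable ?M (\<lambda>x. g_nl (w x))"
    unfolding f_nl_def g_nl_def
    by (rule integrable_continuous_comp[OF fin w _ range]; intro continuous_intros)+
  have int\<phi>: "integrable ?M (\<lambda>x. \<phi> (w x) * (f_nl (w x) - l * g_nl (w x)))"
    unfolding f_nl_def g_nl_def
    by (rule integrable_continuous_comp[OF fin w _ range]; intro continuous_intros \<phi>)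
  \<comment> \<open>Conservation of mass. The nonzero denominator excludes the default value of
    division by zero.\<close>
  have zero: "(LINT x|?M. f_nl (w x) - l * g_nl (w x)) = 0"
    using nz intf intg by (simp add: l_def lambda_nl_def)
  have "0 \<le> (LINT x|?M. \<sigma> * (\<phi> (w x) * (f_nl (w x) - l * g_nl (w x))
                              - \<phi> l * (f_nl (w x) - l * g_nl (w x))))"
  proof (rule integral_nonneg_AE, use range in eventually_elim)
    case (elim x)
    have "0 \<le> (\<phi> (w x) - \<phi> l) * (w x - l)"
    proof (cases "w x \<le> l")
      case True
      then show ?thesis
        using mono_onD[OF \<phi>(2) elim l] by (intro mult_nonpos_nonpos) auto
    next
      case False
      then show ?thesis
        using mono_onD[OF \<phi>(2) l elim] by (intro mult_nonneg_nonneg) auto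
    qed
    then have "0 \<le> (\<phi> (w x) - \<phi> l) * (w x - l) * (\<sigma> * g_nl (w x))"
      using g[OF elim] by (rule mult_nonneg_nonneg)
    then show ?case
      by (simp add: f_nl_def g_nl_def power2_eq_square algebra_simps)
  qed
  \<comment> \<open>Only the outer difference is split, so the inner integral keeps the form in
    which \<open>zero\<close> applies.\<close>
  also have "\<dots> = \<sigma> * ((LINT x|?M. \<phi> (w x) * (f_nl (w x) - l * g_nl (w x)))
                        - \<phi> l * (LINT x|?M. f_nl (w x) - l * g_nl (w x)))"
    using int\<phi> intf intg by (simp del: Bochner_Integration.integral_diff
        add: Bochner_Integration.integral_diff[OF int\<phi>])
  finally show ?thesis
    using zero by (simp add: l_def)
qed

section \<open>Monotonicity and convergence of the energy\<close>

text \<open>The limit is the infimum over \<open>{c..}\<close>: it bounds \<open>E\<close> from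
  below, and once \<open>E\<close> falls under a larger value, monotonicity keeps it there.\<close>

lemma antimono_bounded_below_convergent_at_top:
  fixes E :: "real \<Rightarrow> real"
  assumes anti: "antimono_on {c..} E" and low: "\<And>t. t \<ge> c \<Longrightarrow> m \<le> E t"
  shows "\<exists>L. (E \<longlongrightarrow> L) at_top"
proof (intro exI order_tendstoI)
  let ?L = "INF t\<in>{c..}. E t"
  have bdd: "bdd_below (E ` {c..})" using low by (intro bdd_belowI[of _ m]) auto
  fix y assume y: "y < ?L"
  show "\<forall>\<^sub>F t in at_top. y < E t"
    using eventually_ge_at_top[of c]
    by eventually_elim (meson atLeast_iff bdd cINF_lower order_less_le_trans y)
next
  let ?L = "INF t\<in>{c..}. E t"
  fix y assume "?L < y"
  then obtain s where s: "s \<ge> c" "E s < y"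
    using cInf_lessD[of "E ` {c..}" y] by auto
  show "\<forall>\<^sub>F t in at_top. E t < y"
    using eventually_ge_at_top[of s]
    by eventually_elim (use anti s in \<open>force simp: monotone_on_def\<close>)
qed

theorem proposition3p1:
  fixes \<Omega> :: "(real ^ 'n) set" and u0 :: "real ^ 'n \<Rightarrow> real"
    and u :: "real \<Rightarrow> real ^ 'n \<Rightarrow> real" and \<Phi> :: "real \<Rightarrow> real" and i :: nat
  assumes "open \<Omega>" and "bounded \<Omega>"
    and "i \<in> {1, 2, 3}"
    and "u0 \<in> Linf \<Omega>" and "hyp i \<Omega> u0"
    and "global_solution \<Omega> u0 u"
    and "\<forall>t\<ge>0. AE x in lebesgue_on \<Omega>. u t x \<in> inv_interval i \<Omega> u0"
    and "\<Phi> C1_differentiable_on UNIV"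
    and "mono_on (inv_interval i \<Omega> u0) (deriv \<Phi>)"
  shows "antimono_on {0..} (\<lambda>t. lyap i \<Omega> \<Phi> (u t)) \<and>
    (\<exists>L::real. ((\<lambda>t. lyap i \<Omega> \<Phi> (u t)) \<longlongrightarrow> L) at_top)"
proof -
  let ?M = "lebesgue_on \<Omega>"
  have fin: "finite_measure ?M"
    using assms(1,2) by (intro finite_measure_lebesgue_on lmeasurable_open)
  \<comment> \<open>\<open>g_nl\<close> is nonpositive on the first and third intervals and
    nonnegative on the second, so \<open>(-1) ^ i\<close> corrects its sign. It is opposite to the
    factor \<open>(-1) ^ (i + 1)\<close> in \<open>lyap\<close>, which is why the energy decreases
    in all three cases.\<close>
  obtain a b where ab: "inv_interval i \<Omega> u0 = {a..b}"
    and sign: "\<And>z. z \<in> {a..b} \<Longrightarrow> (-1) ^ i * g_nl z \<ge> 0"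
  proof -
    have "\<exists>a b. inv_interval i \<Omega> u0 = {a..b} \<and> (\<forall>z\<in>{a..b}. (-1) ^ i * g_nl z \<ge> 0)"
      using assms(3)
    proof (elim insertE emptyE)
      assume "i = 1"
      then show ?thesis
        by (intro exI[of _ 1] exI[of _ "ess_sup \<Omega> u0"])
           (auto simp: inv_interval_def g_nl_def mult_nonneg_nonpos)
    next
      assume "i = 2"
      then show ?thesis
        by (intro exI[of _ 0] exI[of _ 1]) (auto simp: inv_interval_def g_nl_def)
    next
      assume "i = 3"
      then show ?thesis
        by (intro exI[of _ "ess_inf \<Omega> u0"] exI[of _ 0])
           (auto simp: inv_interval_def g_nl_def mult_nonpos_nonneg)
    qed
    then show thesis using that by blast
  qed
  note range = assms(7)[unfolded ab]
  from assms(8) obtain \<phi> where "\<And>z. (\<Phi> has_vector_derivative \<phi> z) (at z)"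
    and \<phi>: "continuous_on UNIV \<phi>"
    unfolding C1_differentiable_on_def by auto
  then have \<Phi>: "(\<Phi> has_real_derivative \<phi> z) (at z)" for z
    by (simp add: has_real_derivative_iff_has_vector_derivative)
  \<comment> \<open>Uniqueness of derivatives identifies \<open>deriv \<Phi>\<close> with
    \<open>\<phi>\<close>, transferring the monotonicity.\<close>
  then have mono: "mono_on {a..b} \<phi>"
    using assms(9) DERIV_imp_deriv[OF \<Phi>] by (simp add: ab monotone_on_def)
  obtain ut where ut: "C1_Linf_deriv \<Omega> u ut"
    and eq: "\<And>t. t \<ge> 0 \<Longrightarrow> AE x in ?M. ut t x = f_nl (u t x) - lambda_nl \<Omega> (u t) * g_nl (u t x)"
    and nz: "\<And>t. t \<ge> 0 \<Longrightarrow> (LINT x|?M. g_nl (u t x)) \<noteq> 0"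
    using assms(6) unfolding global_solution_def by blast
  have meas: "u t \<in> borel_measurable ?M" "ut t \<in> borel_measurable ?M" if "t \<ge> 0" for t
    using ut that unfolding C1_Linf_deriv_def Linf_def by auto
  define E where "E t = lyap i \<Omega> \<Phi> (u t)" for t
  define D where "D t = (-1) ^ (i + 1) * (LINT x|?M. \<phi> (u t x) * ut t x)" for t
  have deriv: "(E has_real_derivative D t) (at t within {0..})" if "t \<ge> 0" for t
    unfolding E_def lyap_def D_def
    by (intro DERIV_cmult has_derivative_integral_comp[OF fin ut range \<Phi> \<phi> that])
  have D: "D t \<le> 0" if "t \<ge> 0" for t
  proof -
    have "(LINT x|?M. \<phi> (u t x) * ut t x) =
        (LINT x|?M. \<phi> (u t x) * (f_nl (u t x) - lambda_nl \<Omega> (u t) * g_nl (u t x)))"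
    proof (rule integral_cong_AE)
      have c: "continuous_on UNIV (\<lambda>z. \<phi> z * (f_nl z - lambda_nl \<Omega> (u t) * g_nl z))"
        unfolding f_nl_def g_nl_def by (intro continuous_intros \<phi>)
      show "(\<lambda>x. \<phi> (u t x) * (f_nl (u t x) - lambda_nl \<Omega> (u t) * g_nl (u t x)))
          \<in> borel_measurable ?M"
        by (rule borel_measurable_continuous_on[OF c meas(1)[OF that]])
      show "(\<lambda>x. \<phi> (u t x) * ut t x) \<in> borel_measurable ?M"
        using borel_measurable_continuous_on[OF \<phi> meas(1)[OF that]] meas(2)[OF that]
        by measurable
      show "AE x in ?M. \<phi> (u t x) * ut t x =
          \<phi> (u t x) * (f_nl (u t x) - lambda_nl \<Omega> (u t) * g_nl (u t x))"
        using eq[OF that] by eventually_elim simp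
    qed
    moreover have "0 \<le> (-1) ^ i *
        (LINT x|?M. \<phi> (u t x) * (f_nl (u t x) - lambda_nl \<Omega> (u t) * g_nl (u t x)))"
      using range that
      by (intro integral_mono_reaction_sign[OF fin meas(1)[OF that] _ sign nz[OF that] _ \<phi> mono])
         auto
    ultimately show ?thesis by (simp add: D_def)
  qed
  have anti: "antimono_on {0..} E"
  proof (rule monotone_onI)
    fix s t :: real assume st: "s \<in> {0..}" "t \<in> {0..}" "s \<le> t"
    show "E t \<le> E s"
    \<comment> \<open>The derivative within \<open>{0..}\<close> is one-sided at 0. At interior
      points of \<open>{s..t}\<close> it is two-sided, and continuity suffices at the
      endpoints.\<close>
    proof (rule DERIV_nonpos_imp_decreasing_open[OF st(3)])
      fix x assume x: "s < x" "x < t"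
      then have "(E has_real_derivative D x) (at x within {0<..})"
        using st deriv by (intro DERIV_subset[OF deriv]) auto
      then have "(E has_real_derivative D x) (at x)"
        using x st by (simp add: at_within_open[OF _ open_greaterThan])
      then show "\<exists>y. (E has_real_derivative y) (at x) \<and> y \<le> 0"
        using D x st by auto
    next
      have "continuous_on {0..} E"
        using deriv DERIV_continuous_on by (metis atLeast_iff)
      then show "continuous_on {s..t} E"
        using st by (elim continuous_on_subset) auto
    qed
  qed
  have cont: "continuous_on UNIV \<Phi>"
    using \<Phi> DERIV_isCont continuous_at_imp_continuous_on by blast
  have "compact (\<Phi> ` {a..b})"
    using cont by (intro compact_continuous_image) (auto intro: continuous_on_subset)
  then obtain B where B: "\<And>z. z \<in> {a..b} \<Longrightarrow> \<bar>\<Phi> z\<bar> \<le> B"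
    by (metis bounded_iff compact_imp_bounded imageI real_norm_def)
  \<comment> \<open>A bound uniform in \<open>t\<close>: almost all values of \<open>u\<close> stay
    in the fixed compact interval, where \<open>\<Phi>\<close> is bounded by \<open>B\<close>, and
    the measure is finite. Bounding the absolute value covers both signs in
    \<open>lyap\<close>.\<close>
  have "- (LINT x|?M. B) \<le> E t" if "t \<ge> 0" for t
  proof -
    have AE: "AE x in ?M. \<bar>\<Phi> (u t x)\<bar> \<le> B"
      using range[rule_format, OF that] by eventually_elim (rule B)
    have "\<bar>LINT x|?M. \<Phi> (u t x)\<bar> \<le> (LINT x|?M. \<bar>\<Phi> (u t x)\<bar>)"
      by (rule integral_abs_bound)
    also have "\<dots> \<le> (LINT x|?M. B)"
      using AE fin integrable_continuous_comp[OF fin meas(1)[OF that] cont range[rule_format, OF that]]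
      by (intro integral_mono_AE integrable_abs finite_measure.integrable_const)
    finally have "\<bar>E t\<bar> \<le> (LINT x|?M. B)"
      by (simp add: E_def lyap_def abs_mult)
    then show ?thesis by linarith
  qed
  then have "\<exists>L. (E \<longlongrightarrow> L) at_top"
    by (rule antimono_bounded_below_convergent_at_top[OF anti])
  with anti show ?thesis by (simp add: E_def[abs_def])
qed

end
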